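(* Let $(L,\leq,0,1)$ be a bounded lattice and $a\in L\setminus\{0,1\}$. Let $T_1:[a,1]^2\to[a,1]$ and $T_2:[0,a]^2\to[0,a]$ be two commutative binary operations on the subintervals $[a,1]$ and $[0,a]$ of $L$, respectively, such that $T_1(x,y)\leq x\wedge y$ for all $x,y\in[a,1]$ and $T_2(x,y)\leq x\wedge y$ for all $x,y\in[0,a]$. Let $T:L^2\to L$ be defined by $$T(x,y)=\begin{cases} T_1(x,y), & (x,y)\in[a,1)^2,\\ T_2(x,y), & (x,y)\in[0,a)^2,\\ x\wedge y, & (x,y)\in \big([0,a)\times[a,1)\big)\cup\big([a,1)\times[0,a)\big)\cup\big(L\times\{1\}\big)\cup\big(\{1\}\times L\big),\\ T_2(x\wedge a,y\wedge a), & \text{otherwise.}\end{cases}$$ Then the following statements are equivalent: (I) $T$ is increasing with respect to both variables on $L$. (II) Both of the following hold: (II-1) $T_1$ and $T_2$ are increasing with respect to both variables on $[a,1)$ and $[0,a)$, respectively; (II-2) $\{x\in L: x\in I_a \text{ and } T_2(x\wedge a,a)<x\wedge a\}=\emptyset$. (III) Both of the following hold: (III-1) $T_1$ and $T_2$ are increasing with respect to both variables on $[a,1)$ and $[0,a)$, respectively; (III-2) $I_a=\emptyset$ or $T_2(z\wedge a,a)=z\wedge a$ for all $z\in I_a$.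
   Context: A bounded lattice $(L,\leq,0,1)$ is a lattice with bottom element $0$ and top element $1$; $\wedge$ denotes the meet (greatest lower bound). For $c\leq d$ in $L$, $[c,d]=\{x\in L: c\leq x\leq d\}$ and $[c,d)=\{x\in L: c\leq x<d\}$, where $x<y$ means $x\leq y$ and $x\neq y$. $I_a=\{x\in L: x\not\leq a \text{ and } a\not\leq x\}$ is the set of elements of $L$ incomparable with $a$. A binary operation $F$ is increasing with respect to both variables on a subset $S\subseteq L$ (with $F$ defined on $S^2$) if for all $x,y,z\in S$ with $x\leq y$ one has $F(x,z)\leq F(y,z)$ and $F(z,x)\leq F(z,y)$; thus in (II-1) and (III-1) only the values of $T_1$ on $[a,1)^2$ and of $T_2$ on $[0,a)^2$ are involved. *)

theory Defs
  imports Main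
begin

definition increasing_on :: "'a::order set \<Rightarrow> ('a \<Rightarrow> 'a \<Rightarrow> 'a) \<Rightarrow> bool" where
  "increasing_on S F \<longleftrightarrow>
     (\<forall>x\<in>S. \<forall>y\<in>S. \<forall>z\<in>S. x \<le> y \<longrightarrow> F x z \<le> F y z \<and> F z x \<le> F z y)"

definition incomparables :: "'a::order \<Rightarrow> 'a set" where
  "incomparables a = {x. \<not> x \<le> a \<and> \<not> a \<le> x}"

(* For bot < a < top the first three regions are pairwise disjoint, so the order of the
   tests does not matter. Only values of T1 on {a..top} and of T2 on {bot..a} are used. *)
definition glued_op ::
  "'a::bounded_lattice \<Rightarrow> ('a \<Rightarrow> 'a \<Rightarrow> 'a) \<Rightarrow> ('a \<Rightarrow> 'a \<Rightarrow> 'a) \<Rightarrow> 'a \<Rightarrow> 'a \<Rightarrow> 'a" where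
  "glued_op a T1 T2 x y =
     (if (x, y) \<in> {a..<top} \<times> {a..<top} then T1 x y
      else if (x, y) \<in> {bot..<a} \<times> {bot..<a} then T2 x y
      else if (x, y) \<in> ({bot..<a} \<times> {a..<top}) \<union> ({a..<top} \<times> {bot..<a})
                          \<union> (UNIV \<times> {top}) \<union> ({top} \<times> UNIV) then inf x y
      else T2 (inf x a) (inf y a))"

end

theory Submission
  imports Defs
begin

text \<open>
  Write \<open>T\<close> for the glued operation and \<open>p x = inf x a\<close> for the projection onto the lower interval.
  Call \<open>x\<close> incomparable with \<open>a\<close> bad if \<open>T2 (p x) a < p x\<close>. Such an element breaks monotonicity
  at once: \<open>p x\<close> lies strictly below \<open>a\<close> and below \<open>x\<close>, while \<open>T (p x) a = p x\<close> is a meet and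
  \<open>T x a = T2 (p x) a\<close>, so monotonicity of \<open>T\<close> in the step from \<open>p x\<close> to \<open>x\<close> forces
  \<open>p x \<le> T2 (p x) a\<close>. Monotonicity of \<open>T1\<close> and \<open>T2\<close> on the
  half-open intervals is inherited because \<open>T\<close> restricts to them there.

  Conversely, suppose that no bad element exists. Then elements strictly below \<open>a\<close> and elements
  incomparable with \<open>a\<close> no longer need to be distinguished. Away from the top, the formula for
  \<open>T x y\<close> depends only on which arguments lie above \<open>a\<close>: it is \<open>T1 x y\<close> if both do, \<open>T2 (p x) (p y)\<close> if neither does,
  and the projection of the other argument if exactly one does (lemmas \<open>glued_op_above_not_above\<close>
  and \<open>glued_op_not_above\<close>). Raising an argument then either stays in one of these three
  regimes, where monotonicity is that of \<open>T1\<close>, \<open>T2\<close> or \<open>p\<close>, or passes to a regime with larger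
  values: \<open>T2 (p x) (p z)\<close> is below \<open>p z\<close>, and every projection is below \<open>a\<close>, hence below
  every value of \<open>T1\<close>. Steps to the top are covered by \<open>T x y \<le> inf x y\<close>, and commutativity
  transfers everything to the second argument.

  That there is no bad element is the same as \<open>T2 (p z) a = p z\<close> for all \<open>z\<close> incomparable with \<open>a\<close>,
  since \<open>T2 (p x) a \<le> p x\<close> always holds.
\<close>

lemma increasing_onD:
  assumes "increasing_on S F" "x \<in> S" "y \<in> S" "z \<in> S" "x \<le> y"
  shows "F x z \<le> F y z"
  using assms unfolding increasing_on_def by blast

lemma increasing_on_if_commutative:
  assumes comm: "\<And>x y. x \<in> S \<Longrightarrow> y \<in> S \<Longrightarrow> F x y = F y x"
    and mono: "\<And>x y z. x \<in> S \<Longrightarrow> y \<in> S \<Longrightarrow> z \<in> S \<Longrightarrow> x \<le> y \<Longrightarrow> F x z \<le> F y z"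
  shows "increasing_on S F"
  unfolding increasing_on_def by (metis comm mono)

lemma increasing_on_restrict:
  assumes "increasing_on UNIV F" "\<And>x y. x \<in> S \<Longrightarrow> y \<in> S \<Longrightarrow> F x y = G x y"
  shows "increasing_on S G"
  using assms unfolding increasing_on_def by (metis UNIV_I)

lemma inf_less_iff_not_above:
  fixes a x :: "'a::bounded_lattice"
  shows "inf x a < a \<longleftrightarrow> \<not> a \<le> x"
  by (metis inf.absorb_iff1 inf.commute inf_le2 order.strict_iff_order)

lemma glued_op_top [simp]:
  fixes a :: "'a::bounded_lattice"
  shows "glued_op a T1 T2 top y = y" "glued_op a T1 T2 x top = x"
  by (auto simp: glued_op_def less_top dest: less_le_trans)

lemma glued_op_upper:
  fixes a :: "'a::bounded_lattice"
  assumes "x \<in> {a..<top}" "y \<in> {a..<top}"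
  shows "glued_op a T1 T2 x y = T1 x y"
  using assms by (simp add: glued_op_def)

lemma glued_op_lower:
  fixes a :: "'a::bounded_lattice"
  assumes "x \<in> {bot..<a}" "y \<in> {bot..<a}"
  shows "glued_op a T1 T2 x y = T2 x y"
  using assms by (auto simp: glued_op_def)

lemma glued_op_lower_upper:
  fixes a :: "'a::bounded_lattice"
  assumes "x \<in> {bot..<a}" "y \<in> {a..<top}"
  shows "glued_op a T1 T2 x y = x"
  using assms by (auto simp: glued_op_def inf.absorb1)

lemma glued_op_incomparable_upper:
  fixes a :: "'a::bounded_lattice"
  assumes "x \<in> incomparables a" "y \<in> {a..<top}"
  shows "glued_op a T1 T2 x y = T2 (inf x a) a"
  using assms by (auto simp: glued_op_def incomparables_def inf.absorb2)

text \<open>On the part of the lattice not above \<open>a\<close>, the definition distinguishes elements below \<open>a\<close>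
  from incomparable ones, but the former are fixed by the projection.\<close>

lemma glued_op_not_above:
  fixes a :: "'a::bounded_lattice"
  assumes "\<not> a \<le> x" "\<not> a \<le> y"
  shows "glued_op a T1 T2 x y = T2 (inf x a) (inf y a)"
proof (cases "x \<in> {bot..<a} \<and> y \<in> {bot..<a}")
  case True
  then have "inf x a = x" "inf y a = y" by (auto intro: inf.absorb1)
  with True show ?thesis by (simp add: glued_op_lower)
next
  case False
  moreover have "x \<noteq> top" "y \<noteq> top" using assms by auto
  ultimately show ?thesis using assms by (clarsimp simp: glued_op_def)
qed

lemma glued_op_commute:
  fixes a :: "'a::bounded_lattice"
  assumes "\<And>x y. x \<in> {a..top} \<Longrightarrow> y \<in> {a..top} \<Longrightarrow> T1 x y = T1 y x"
    and "\<And>x y. x \<in> {bot..a} \<Longrightarrow> y \<in> {bot..a} \<Longrightarrow> T2 x y = T2 y x"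
  shows "glued_op a T1 T2 x y = glued_op a T1 T2 y x"
  unfolding glued_op_def
  by (intro if_cong) (auto intro: assms inf.commute)

lemma glued_op_le_inf:
  fixes a :: "'a::bounded_lattice"
  assumes T1_le: "\<And>x y. x \<in> {a..top} \<Longrightarrow> y \<in> {a..top} \<Longrightarrow> T1 x y \<le> inf x y"
    and T2_le: "\<And>x y. x \<in> {bot..a} \<Longrightarrow> y \<in> {bot..a} \<Longrightarrow> T2 x y \<le> inf x y"
  shows "glued_op a T1 T2 x y \<le> inf x y"
proof -
  have "T2 (inf x a) (inf y a) \<le> inf (inf x a) (inf y a)"
    by (rule T2_le) simp_all
  also have "\<dots> \<le> inf x y"
    by (intro inf_mono inf_le1)
  finally have "T2 (inf x a) (inf y a) \<le> inf x y" .
  then show ?thesis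
    using T1_le[of x y] T2_le[of x y] by (auto simp: glued_op_def)
qed

text \<open>Once \<open>a\<close> acts as a neutral element on the projections of the incomparable elements, these
  elements behave against the upper interval exactly as elements below \<open>a\<close> do.\<close>

lemma glued_op_above_not_above:
  fixes a :: "'a::bounded_lattice"
  assumes neutral: "\<And>z. z \<in> incomparables a \<Longrightarrow> T2 (inf z a) a = inf z a"
    and "\<not> a \<le> x" "y \<in> {a..<top}"
  shows "glued_op a T1 T2 x y = inf x a"
proof (cases "x \<le> a")
  case True
  with assms have "x \<in> {bot..<a}" by auto
  with True show ?thesis
    using assms by (simp add: glued_op_lower_upper inf.absorb1)
next
  case False
  with assms have "x \<in> incomparables a" by (simp add: incomparables_def)
  then show ?thesis
    using assms by (simp add: glued_op_incomparable_upper)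
qed

text \<open>The step from \<open>inf x a\<close> up to \<open>x\<close>, with second argument \<open>a\<close>, crosses from the region where
  the operation is a meet into the region where it is computed by \<open>T2\<close>.\<close>

lemma glued_op_increasing_imp_le:
  fixes a :: "'a::bounded_lattice"
  assumes inc: "increasing_on UNIV (glued_op a T1 T2)"
    and "a \<noteq> top" and x: "x \<in> incomparables a"
  shows "inf x a \<le> T2 (inf x a) a"
proof -
  have a: "a \<in> {a..<top}"
    using \<open>a \<noteq> top\<close> by (simp add: less_top)
  have "inf x a \<in> {bot..<a}"
    using x by (simp add: incomparables_def inf_less_iff_not_above)
  then have "inf x a = glued_op a T1 T2 (inf x a) a"
    using a by (simp add: glued_op_lower_upper)
  also have "\<dots> \<le> glued_op a T1 T2 x a"
    using inc by (rule increasing_onD) simp_all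
  also have "\<dots> = T2 (inf x a) a"
    using x a by (rule glued_op_incomparable_upper)
  finally show ?thesis .
qed

text \<open>By commutativity only the first argument has to be raised, from \<open>x\<close> to \<open>y\<close>. Whether \<open>z\<close> lies
  above \<open>a\<close> is then fixed, and \<open>x\<close> can cross into the upper interval but never leave it, so each of
  the two kinds of \<open>z\<close> allows three positions of \<open>x\<close> and \<open>y\<close>.\<close>

lemma glued_op_increasing:
  fixes a :: "'a::bounded_lattice"
  assumes T1_closed: "\<And>x y. x \<in> {a..top} \<Longrightarrow> y \<in> {a..top} \<Longrightarrow> T1 x y \<in> {a..top}"
    and T1_comm: "\<And>x y. x \<in> {a..top} \<Longrightarrow> y \<in> {a..top} \<Longrightarrow> T1 x y = T1 y x"
    and T2_comm: "\<And>x y. x \<in> {bot..a} \<Longrightarrow> y \<in> {bot..a} \<Longrightarrow> T2 x y = T2 y x"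
    and T1_le: "\<And>x y. x \<in> {a..top} \<Longrightarrow> y \<in> {a..top} \<Longrightarrow> T1 x y \<le> inf x y"
    and T2_le: "\<And>x y. x \<in> {bot..a} \<Longrightarrow> y \<in> {bot..a} \<Longrightarrow> T2 x y \<le> inf x y"
    and T1_inc: "increasing_on {a..<top} T1" and T2_inc: "increasing_on {bot..<a} T2"
    and neutral: "\<And>z. z \<in> incomparables a \<Longrightarrow> T2 (inf z a) a = inf z a"
  shows "increasing_on UNIV (glued_op a T1 T2)"
proof (rule increasing_on_if_commutative)
  let ?T = "glued_op a T1 T2"
  have comm: "?T x y = ?T y x" for x y
    using T1_comm T2_comm by (rule glued_op_commute)
  then show "?T x y = ?T y x" for x y .
  have le: "?T x y \<le> inf x y" for x y
    using T1_le T2_le by (rule glued_op_le_inf)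
  have mixed: "?T x y = inf x a" if "\<not> a \<le> x" "y \<in> {a..<top}" for x y
    using neutral that by (rule glued_op_above_not_above)
  fix x y z :: 'a
  assume "x \<le> y"
  consider (z_top) "z = top" | (y_top) "y = top"
    | (upper) "z \<in> {a..<top}" "y \<noteq> top" | (not_above) "\<not> a \<le> z" "y \<noteq> top"
    by (metis atLeastLessThan_iff less_top)
  then show "?T x z \<le> ?T y z"
  proof cases
    case z_top
    with \<open>x \<le> y\<close> show ?thesis by simp
  next
    case y_top
    with le[of x z] show ?thesis by simp
  next
    case upper
    have x: "x \<noteq> top" using \<open>x \<le> y\<close> upper by (auto simp: top_unique)
    show ?thesis
    proof (cases "a \<le> x")
      case True
      with \<open>x \<le> y\<close> upper x have "x \<in> {a..<top}" "y \<in> {a..<top}" by (auto simp: less_top)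
      with upper \<open>x \<le> y\<close> T1_inc show ?thesis
        by (simp add: glued_op_upper increasing_onD)
    next
      case False
      then have eq: "?T x z = inf x a"
        using upper by (simp add: mixed)
      show ?thesis
      proof (cases "a \<le> y")
        case True
        have "inf x a \<le> a" by simp
        also have "a \<le> T1 y z" using T1_closed[of y z] True upper by simp
        also have "T1 y z = ?T y z" using True upper by (simp add: glued_op_upper less_top)
        finally show ?thesis using eq by simp
      next
        case False
        with upper \<open>x \<le> y\<close> eq show ?thesis by (simp add: mixed le_infI1)
      qed
    qed
  next
    case not_above
    have x: "x \<noteq> top" using \<open>x \<le> y\<close> not_above by (auto simp: top_unique)
    have above: "?T w z = inf z a" if "a \<le> w" "w \<noteq> top" for w
      using that not_above mixed[of z w] comm[of w z] by (simp add: less_top)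
    show ?thesis
    proof (cases "a \<le> x")
      case True
      then have "a \<le> y" using \<open>x \<le> y\<close> by (rule order_trans)
      with True x not_above show ?thesis by (simp add: above)
    next
      case False
      then have eq: "?T x z = T2 (inf x a) (inf z a)"
        using not_above by (simp add: glued_op_not_above)
      show ?thesis
      proof (cases "a \<le> y")
        case True
        have "T2 (inf x a) (inf z a) \<le> inf z a"
          using T2_le[of "inf x a" "inf z a"] by simp
        with eq True not_above show ?thesis by (simp add: above)
      next
        case y: False
        have "T2 (inf x a) (inf z a) \<le> T2 (inf y a) (inf z a)"
          using T2_inc
        proof (rule increasing_onD)
          show "inf x a \<le> inf y a" using \<open>x \<le> y\<close> by (simp add: le_infI1)
        qed (use False y not_above in \<open>simp_all add: inf_less_iff_not_above\<close>)
        with eq y not_above show ?thesis by (simp add: glued_op_not_above)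
      qed
    qed
  qed
qed

theorem theorem4:
  fixes a :: "'a::bounded_lattice"
    and T1 T2 :: "'a \<Rightarrow> 'a \<Rightarrow> 'a"
  assumes a_bot: "a \<noteq> bot" and a_top: "a \<noteq> top"
    and T1_closed: "\<And>x y. x \<in> {a..top} \<Longrightarrow> y \<in> {a..top} \<Longrightarrow> T1 x y \<in> {a..top}"
    and T2_closed: "\<And>x y. x \<in> {bot..a} \<Longrightarrow> y \<in> {bot..a} \<Longrightarrow> T2 x y \<in> {bot..a}"
    and T1_comm: "\<And>x y. x \<in> {a..top} \<Longrightarrow> y \<in> {a..top} \<Longrightarrow> T1 x y = T1 y x"
    and T2_comm: "\<And>x y. x \<in> {bot..a} \<Longrightarrow> y \<in> {bot..a} \<Longrightarrow> T2 x y = T2 y x"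
    and T1_le: "\<And>x y. x \<in> {a..top} \<Longrightarrow> y \<in> {a..top} \<Longrightarrow> T1 x y \<le> inf x y"
    and T2_le: "\<And>x y. x \<in> {bot..a} \<Longrightarrow> y \<in> {bot..a} \<Longrightarrow> T2 x y \<le> inf x y"
  shows "(increasing_on UNIV (glued_op a T1 T2) \<longleftrightarrow>
            (increasing_on {a..<top} T1 \<and> increasing_on {bot..<a} T2) \<and>
            {x. x \<in> incomparables a \<and> T2 (inf x a) a < inf x a} = {})
       \<and> ((increasing_on {a..<top} T1 \<and> increasing_on {bot..<a} T2) \<and>
            {x. x \<in> incomparables a \<and> T2 (inf x a) a < inf x a} = {} \<longleftrightarrow>
          (increasing_on {a..<top} T1 \<and> increasing_on {bot..<a} T2) \<and>
            (incomparables a = {} \<or> (\<forall>z\<in>incomparables a. T2 (inf z a) a = inf z a)))"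
proof -
  let ?T = "glued_op a T1 T2"
  have T2_le_inf: "T2 (inf x a) a \<le> inf x a" for x
    using T2_le[of "inf x a" a] by simp
  have no_defect_iff: "{x. x \<in> incomparables a \<and> T2 (inf x a) a < inf x a} = {} \<longleftrightarrow>
      (\<forall>z\<in>incomparables a. T2 (inf z a) a = inf z a)"
    using T2_le_inf by (auto simp: order.strict_iff_order)
  have "increasing_on UNIV ?T \<longleftrightarrow>
      (increasing_on {a..<top} T1 \<and> increasing_on {bot..<a} T2) \<and>
      (\<forall>z\<in>incomparables a. T2 (inf z a) a = inf z a)" (is "_ \<longleftrightarrow> ?inc \<and> ?neutral")
  proof
    assume inc: "increasing_on UNIV ?T"
    have "increasing_on {a..<top} T1"
      using inc glued_op_upper by (rule increasing_on_restrict)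
    moreover have "increasing_on {bot..<a} T2"
      using inc glued_op_lower by (rule increasing_on_restrict)
    moreover have ?neutral
      using glued_op_increasing_imp_le[OF inc a_top] T2_le_inf
      by (blast intro: order.antisym)
    ultimately show "?inc \<and> ?neutral" by blast
  next
    assume "?inc \<and> ?neutral"
    then show "increasing_on UNIV ?T"
      using glued_op_increasing[OF T1_closed T1_comm T2_comm T1_le T2_le] by blast
  qed
  then show ?thesis
    unfolding no_defect_iff by blast
qed

end
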